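(* Let $n\ge2$ and let $\Sigma\subset\mathbb R^n$ be an embedded $C^2$ hypersurface. Suppose that near each point of $\Sigma$ there is a regular defining function $F:U\to\mathbb R$ of $\Sigma$ such that $C_{ij}[F]=0$ on $\Sigma\cap U$ for all $1\le i<j\le n$. Then the second fundamental form of $\Sigma$ vanishes identically.
   Context: A regular defining function of $\Sigma$ near a point of $\Sigma$ is a $C^2$ function $F$ on an open neighborhood $U\subset\mathbb R^n$ of that point with $\Sigma\cap U=\{x\in U:F(x)=0\}$ and $\nabla F\ne0$ on $\Sigma\cap U$. With subscripts on $F$ denoting partial derivatives, for $i<j$, $$C_{ij}[F]=F_j^2F_{ii}+F_i^2F_{jj}-2F_iF_jF_{ij}.$$ The vanishing of $C_{ij}[F]$ along $\Sigma$ does not depend on the choice of regular defining function, so the hypothesis may equivalently be required for every local regular defining function. *)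

theory Defs
  imports "HOL-Analysis.Analysis"
begin

definition C1_on :: "'a::real_normed_vector set \<Rightarrow> ('a \<Rightarrow> 'b::real_normed_vector) \<Rightarrow> bool" where
  "C1_on U f \<longleftrightarrow> (\<exists>f' :: 'a \<Rightarrow> 'a \<Rightarrow>\<^sub>L 'b.
     (\<forall>x\<in>U. (f has_derivative blinfun_apply (f' x)) (at x)) \<and> continuous_on U f')"

definition C2_on :: "'a::real_normed_vector set \<Rightarrow> ('a \<Rightarrow> 'b::real_normed_vector) \<Rightarrow> bool" where
  "C2_on U f \<longleftrightarrow> (\<exists>f' :: 'a \<Rightarrow> 'a \<Rightarrow>\<^sub>L 'b.
     (\<forall>x\<in>U. (f has_derivative blinfun_apply (f' x)) (at x)) \<and> C1_on U f')"

definition partial :: "'n \<Rightarrow> (real^'n \<Rightarrow> real) \<Rightarrow> real^'n \<Rightarrow> real" where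
  "partial i F x = frechet_derivative F (at x) (axis i 1)"

definition gradient :: "(real^'n \<Rightarrow> real) \<Rightarrow> real^'n \<Rightarrow> real^'n" where
  "gradient F x = (\<chi> i. partial i F x)"

text \<open>Embedded means locally flattened to a coordinate hyperplane by an ambient \<open>C\<^sup>2\<close> diffeomorphism
  (slice charts).\<close>

definition embedded_C2_hypersurface :: "(real^'n) set \<Rightarrow> bool" where
  "embedded_C2_hypersurface \<Sigma> \<longleftrightarrow>
     (\<forall>p\<in>\<Sigma>. \<exists>(U :: (real^'n) set) (V :: (real^'n) set) \<phi> \<psi> k. open U \<and> p \<in> U \<and> open V \<and>
        homeomorphism U V \<phi> \<psi> \<and> C2_on U \<phi> \<and> C2_on V \<psi> \<and>
        \<phi> ` (\<Sigma> \<inter> U) = {y \<in> V. y $ k = 0})"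

definition regular_defining_function ::
    "(real^'n) set \<Rightarrow> real^'n \<Rightarrow> (real^'n) set \<Rightarrow> (real^'n \<Rightarrow> real) \<Rightarrow> bool" where
  "regular_defining_function \<Sigma> p U F \<longleftrightarrow>
     open U \<and> p \<in> U \<and> C2_on U F \<and>
     \<Sigma> \<inter> U = {x \<in> U. F x = 0} \<and> (\<forall>x \<in> \<Sigma> \<inter> U. gradient F x \<noteq> 0)"

definition Cij :: "'n \<Rightarrow> 'n \<Rightarrow> (real^'n \<Rightarrow> real) \<Rightarrow> real^'n \<Rightarrow> real" where
  "Cij i j F x =
     (partial j F x)\<^sup>2 * partial i (partial i F) x
   + (partial i F x)\<^sup>2 * partial j (partial j F) x
   - 2 * partial i F x * partial j F x * partial j (partial i F) x"

definition tangent_space :: "(real^'n) set \<Rightarrow> real^'n \<Rightarrow> (real^'n) set" where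
  "tangent_space \<Sigma> p = {v. \<exists>\<gamma>::real \<Rightarrow> real^'n. \<exists>\<epsilon>>0.
     \<gamma> 0 = p \<and> (\<forall>t. \<bar>t\<bar> < \<epsilon> \<longrightarrow> \<gamma> t \<in> \<Sigma>) \<and> (\<gamma> has_vector_derivative v) (at 0)}"

text \<open>\<open>C\<^sup>1\<close> regularity along \<open>\<Sigma>\<close> is expressed by an extension to the ambient open set \<open>U\<close>;
  outside \<open>\<Sigma>\<close> the values of \<open>N\<close> are unconstrained. Derivatives of \<open>N\<close> in directions tangent to
  \<open>\<Sigma>\<close> do not depend on the extension.\<close>

definition local_unit_normal ::
    "(real^'n) set \<Rightarrow> (real^'n) set \<Rightarrow> (real^'n \<Rightarrow> real^'n) \<Rightarrow> bool" where
  "local_unit_normal \<Sigma> U N \<longleftrightarrow> open U \<and> C1_on U N \<and>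
     (\<forall>x \<in> \<Sigma> \<inter> U. norm (N x) = 1 \<and> (\<forall>v \<in> tangent_space \<Sigma> x. N x \<bullet> v = 0))"

text \<open>Second fundamental form at \<open>p\<close> with respect to the unit normal field \<open>N\<close>, meaningful for
  \<open>v\<close>, \<open>w\<close> tangent at \<open>p\<close>. The opposite choice of \<open>N\<close> changes only its sign.\<close>

definition second_fundamental_form ::
    "(real^'n \<Rightarrow> real^'n) \<Rightarrow> real^'n \<Rightarrow> real^'n \<Rightarrow> real^'n \<Rightarrow> real" where
  "second_fundamental_form N p v w = - (frechet_derivative N (at p) v \<bullet> w)"

text \<open>\<open>\<Sigma>\<close> need not be orientable, so vanishing of the second fundamental form is required with
  respect to every local unit normal field. Such fields exist near every point, see
  \<open>local_unit_normal_exists\<close> below.\<close>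

definition second_fundamental_form_vanishes :: "(real^'n) set \<Rightarrow> bool" where
  "second_fundamental_form_vanishes \<Sigma> \<longleftrightarrow>
     (\<forall>U N. local_unit_normal \<Sigma> U N \<longrightarrow>
        (\<forall>p \<in> \<Sigma> \<inter> U. \<forall>v \<in> tangent_space \<Sigma> p. \<forall>w \<in> tangent_space \<Sigma> p.
           second_fundamental_form N p v w = 0))"

lemma C1_on_subset: "C1_on U f \<Longrightarrow> V \<subseteq> U \<Longrightarrow> C1_on V f"
  unfolding C1_on_def using continuous_on_subset by blast

lemma C1_on_imp_continuous_on: "C1_on U f \<Longrightarrow> continuous_on U f"
  unfolding C1_on_def by (meson continuous_at_imp_continuous_on has_derivative_continuous)

lemma C1_on_normalize:
  fixes g :: "'a::real_normed_vector \<Rightarrow> 'b::real_inner"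
  assumes g: "C1_on U g" and nz: "\<And>x. x \<in> U \<Longrightarrow> g x \<noteq> 0"
  shows "C1_on U (\<lambda>x. g x /\<^sub>R norm (g x))"
proof -
  obtain g' :: "'a \<Rightarrow> 'a \<Rightarrow>\<^sub>L 'b" where
    d: "\<And>x. x \<in> U \<Longrightarrow> (g has_derivative blinfun_apply (g' x)) (at x)" and c: "continuous_on U g'"
    using g by (auto simp: C1_on_def)
  have cg: "continuous_on U g"
    using g by (rule C1_on_imp_continuous_on)
  define h where "h x = inverse (norm (g x)) *\<^sub>R g' x
      - inverse (norm (g x) ^ 3) *\<^sub>R (blinfun_scaleR_left (g x) o\<^sub>L (blinfun_inner_right (g x) o\<^sub>L g' x))" for x
  have "continuous_on U h"
    unfolding h_def using nz
    by (intro continuous_intros cg c bounded_linear.continuous_on[OF bounded_linear_blinfun_inner_right]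
        bounded_linear.continuous_on[OF bounded_linear_blinfun_scaleR_left]) auto
  moreover have "((\<lambda>x. g x /\<^sub>R norm (g x)) has_derivative blinfun_apply (h x)) (at x)" if "x \<in> U" for x
  proof -
    have n: "((\<lambda>x. norm (g x)) has_derivative (\<lambda>t. g' x t \<bullet> sgn (g x))) (at x)"
      by (rule has_derivative_compose[OF d[OF that] has_derivative_norm[OF nz[OF that]], unfolded comp_def])
    show ?thesis
      using nz[OF that]
      by (auto intro!: derivative_eq_intros d[OF that] n ext
        simp: h_def blinfun.bilinear_simps sgn_div_norm power3_eq_cube inner_commute algebra_simps)
  qed
  ultimately show ?thesis
    by (auto simp: C1_on_def)
qed

lemma local_unit_normal_exists:
  fixes \<Sigma> :: "(real^'n) set"
  assumes "regular_defining_function \<Sigma> p U F" "p \<in> \<Sigma>"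
  shows "\<exists>W N. p \<in> W \<and> local_unit_normal \<Sigma> W N"
proof -
  obtain f' :: "real^'n \<Rightarrow> (real^'n) \<Rightarrow>\<^sub>L real" and f'' where
    f': "\<And>x. x \<in> U \<Longrightarrow> (F has_derivative blinfun_apply (f' x)) (at x)" and
    f'': "\<And>x. x \<in> U \<Longrightarrow> (f' has_derivative blinfun_apply (f'' x)) (at x)" and c: "continuous_on U f''"
    and U: "open U" "p \<in> U" "\<Sigma> \<inter> U = {x \<in> U. F x = 0}" "\<forall>x \<in> \<Sigma> \<inter> U. gradient F x \<noteq> 0"
    using assms by (force simp: regular_defining_function_def C2_on_def C1_on_def)
  define L :: "((real^'n) \<Rightarrow>\<^sub>L real) \<Rightarrow> real^'n" where "L b = (\<chi> i. blinfun_apply b (axis i 1))" for b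
  have L: "bounded_linear L"
  proof -
    have "L = (\<lambda>b. \<Sum>i\<in>UNIV. blinfun_apply b (axis i 1) *\<^sub>R axis i 1)"
    proof
      fix b
      have "(\<Sum>i\<in>UNIV. L b $ i *s axis i 1) = L b"
        by (rule basis_expansion)
      then show "L b = (\<Sum>i\<in>UNIV. blinfun_apply b (axis i 1) *\<^sub>R axis i 1)"
        by (simp only: L_def vec_lambda_beta scalar_mult_eq_scaleR)
    qed
    moreover have "bounded_linear (\<lambda>b. \<Sum>i\<in>UNIV. blinfun_apply b (axis i 1) *\<^sub>R axis i 1 :: real^'n)"
      by (intro bounded_linear_sum bounded_linear_scaleR_const blinfun.bounded_linear_left)
    ultimately show ?thesis
      by simp
  qed
  define g where "g x = L (f' x)" for x
  have g: "gradient F x = g x" if "x \<in> U" for x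
    using frechet_derivative_at[OF f'[OF that]]
    by (auto simp: g_def L_def gradient_def partial_def)
  have gv: "g x \<bullet> v = f' x v" for x v
  proof -
    have "f' x v = f' x (\<Sum>i\<in>UNIV. v $ i *\<^sub>R axis i 1)"
      by (metis basis_expansion scalar_mult_eq_scaleR)
    then show ?thesis
      by (simp add: blinfun.bilinear_simps blinfun.sum_right inner_vec_def g_def L_def mult.commute)
  qed
  have gC1: "C1_on U g"
    unfolding C1_on_def
  proof (intro exI[of _ "\<lambda>x. Blinfun L o\<^sub>L f'' x"] conjI ballI)
    show "continuous_on U (\<lambda>x. Blinfun L o\<^sub>L f'' x)"
      by (intro continuous_intros c)
    show "(g has_derivative blinfun_apply (Blinfun L o\<^sub>L f'' x)) (at x)" if "x \<in> U" for x
      using bounded_linear.has_derivative[OF L f''[OF that]]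
      by (simp add: g_def[abs_def] bounded_linear_Blinfun_apply[OF L] blinfun_compose.rep_eq comp_def)
  qed
  have "continuous_on U g"
    using gC1 by (rule C1_on_imp_continuous_on)
  then have W: "open (U \<inter> g -` (- {0}))" (is "open ?W")
    using U(1) continuous_open_preimage by blast
  have "C1_on ?W g"
    using gC1 by (rule C1_on_subset) simp
  then have "C1_on ?W (\<lambda>x. g x /\<^sub>R norm (g x))"
    by (rule C1_on_normalize) auto
  moreover have "g x \<bullet> v = 0" if x: "x \<in> \<Sigma> \<inter> U" and v: "v \<in> tangent_space \<Sigma> x" for x v
  proof -
    obtain \<gamma> \<epsilon> where \<gamma>: "\<gamma> 0 = x" "\<epsilon> > 0" "\<And>t. \<bar>t\<bar> < \<epsilon> \<Longrightarrow> \<gamma> t \<in> \<Sigma>"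
        "(\<gamma> has_vector_derivative v) (at 0)"
      using v by (auto simp: tangent_space_def)
    have d: "((F \<circ> \<gamma>) has_derivative (\<lambda>t. f' x (t *\<^sub>R v))) (at 0)"
      using diff_chain_at[of \<gamma> "\<lambda>t. t *\<^sub>R v" 0 F "f' x"] \<gamma> f'[of x] x
      by (auto simp: has_vector_derivative_def comp_def)
    have "isCont \<gamma> 0"
      using \<gamma>(4) has_vector_derivative_continuous by blast
    then have "\<forall>\<^sub>F t in at 0. \<gamma> t \<in> U"
      using topological_tendstoD[of \<gamma> "\<gamma> 0" "at 0" U] U(1) x \<gamma>(1) by (auto simp: isCont_def)
    moreover have "\<forall>\<^sub>F t in at 0. \<bar>t::real\<bar> < \<epsilon>"
      using \<gamma>(2) by (auto simp: eventually_at intro!: exI[of _ \<epsilon>])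
    ultimately have ev: "\<forall>\<^sub>F t in at 0. (F \<circ> \<gamma>) t = 0"
      by eventually_elim (use U(3) \<gamma>(3) in auto)
    have "((\<lambda>t. 0::real) has_derivative (\<lambda>t. f' x (t *\<^sub>R v))) (at 0)"
      by (rule has_derivative_transform_eventually[OF d ev]) (use U(3) x \<gamma>(1) in auto)
    then have "(\<lambda>t::real. f' x (t *\<^sub>R v)) = (\<lambda>t. 0)"
      by (rule has_derivative_unique) (rule has_derivative_const)
    then have "f' x (1 *\<^sub>R v) = 0"
      by meson
    then show ?thesis
      by (simp add: gv)
  qed
  ultimately have "local_unit_normal \<Sigma> ?W (\<lambda>x. g x /\<^sub>R norm (g x))"
    using W by (auto simp: local_unit_normal_def)
  moreover have "p \<in> ?W"
    using U g assms(2) by auto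
  ultimately show ?thesis
    by (intro exI conjI)
qed

end

theory Submission
  imports Defs
begin

text \<open>Where no partial \<open>F\<^sub>i\<close> vanishes, the equations \<open>C\<^sub>i\<^sub>j[F] = 0\<close> say that the Hessian is isotropic on all
  \<open>e\<^sub>i / F\<^sub>i - e\<^sub>j / F\<^sub>j\<close>, which by polarization makes it zero on the tangent space. Where \<open>F\<^sub>i\<close> vanishes
  the equations degenerate, but if \<open>F\<^sub>i = 0\<close> along a whole piece of \<open>\<Sigma>\<close>, then differentiating this along
  \<open>\<Sigma>\<close> kills the Hessian on pairs \<open>(v, e\<^sub>i)\<close> with \<open>v\<close> tangent. Points near which every \<open>F\<^sub>i\<close> is either
  nowhere or identically zero on \<open>\<Sigma>\<close> are dense (maximize the number of nonzero partials on a relatively open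
  set), and the remaining points follow by continuity.\<close>

section \<open>Symmetry of second derivatives, gradient and Hessian\<close>

text \<open>The second difference \<open>\<Delta> t v w\<close> is symmetric in \<open>v\<close> and
  \<open>w\<close>, and divided by \<open>t\<^sup>2\<close> it tends to
  \<open>H v \<bullet> w\<close>. Since \<open>g\<close> is compared only with its linearization at
  \<open>x\<close>, differentiability of \<open>g\<close> at that single point suffices.\<close>

lemma second_derivative_symmetric:
  fixes F :: "'a::real_inner \<Rightarrow> real"
  assumes U: "open U" "x \<in> U"
    and F: "\<And>y. y \<in> U \<Longrightarrow> (F has_derivative (\<lambda>v. g y \<bullet> v)) (at y)"
    and g: "(g has_derivative H) (at x)"
  shows "H v \<bullet> w = H w \<bullet> v"
proof -
  define \<Delta> where "\<Delta> t v w = F (x + t *\<^sub>R v + t *\<^sub>R w) - F (x + t *\<^sub>R v) - F (x + t *\<^sub>R w) + F x" for t v w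
  interpret H: bounded_linear H
    using g by (rule has_derivative_bounded_linear)
  have lim: "((\<lambda>t. \<Delta> t v w / t\<^sup>2) \<longlongrightarrow> H v \<bullet> w) (at_right 0)" for v w
  proof (rule tendstoI)
    fix e :: real
    assume "e > 0"
    define K where "K = norm v + norm w + 1"
    have K: "K > 0" "norm v + norm w \<le> K" "norm w \<le> K"
      by (auto simp: K_def add_nonneg_pos)
    \<comment> \<open>With this choice the final error \<open>2 * e' * K * K\<close> is two thirds
      of \<open>e\<close>.\<close>
    define e' where "e' = e / (3 * K * K)"
    have "e' > 0"
      using \<open>e > 0\<close> K by (simp add: e'_def)
    then obtain d1 where d1: "d1 > 0"
      "\<And>y. norm (y - x) < d1 \<Longrightarrow> norm (g y - g x - H (y - x)) \<le> e' * norm (y - x)"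
      using g[unfolded has_derivative_at_alt] by blast
    obtain d2 where d2: "d2 > 0" "ball x d2 \<subseteq> U"
      using U openE by blast
    define d where "d = min d1 d2"
    have d: "d > 0"
      using d1 d2 by (simp add: d_def)
    have "\<forall>\<^sub>F t in at_right 0. 0 < t \<and> t < d / K"
      using K d by (auto simp: eventually_at_right_field intro!: exI[of _ "d / K"])
    then show "\<forall>\<^sub>F t in at_right 0. dist (\<Delta> t v w / t\<^sup>2) (H v \<bullet> w) < e"
    proof eventually_elim
      fix t
      assume t: "0 < t \<and> t < d / K"
      have tK: "t * K < d"
        using t K by (simp add: field_simps)
      have small: "norm (a *\<^sub>R v + b *\<^sub>R w) \<le> t * K"
        if "0 \<le> a" "a \<le> t" "0 \<le> b" "b \<le> t" for a b
      proof -
        have "norm (a *\<^sub>R v + b *\<^sub>R w) \<le> a * norm v + b * norm w"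
          using norm_triangle_ineq[of "a *\<^sub>R v" "b *\<^sub>R w"] that by simp
        also have "\<dots> \<le> t * norm v + t * norm w"
          using that by (intro add_mono mult_right_mono) auto
        also have "\<dots> \<le> t * K"
          using t K(2) by (metis distrib_left less_eq_real_def mult_left_mono)
        finally show ?thesis .
      qed
      have inU: "x + a *\<^sub>R v + b *\<^sub>R w \<in> U" if "0 \<le> a" "a \<le> t" "0 \<le> b" "b \<le> t" for a b
      proof -
        have "dist x (x + a *\<^sub>R v + b *\<^sub>R w) = norm (a *\<^sub>R v + b *\<^sub>R w)"
          by (metis add.assoc add_diff_cancel_left' dist_commute dist_norm)
        then show ?thesis
          using small[OF that] tK d2 by (auto simp: d_def)
      qed
      \<comment> \<open>\<open>\<Delta> t v w\<close> equals \<open>f t - f 0\<close>, so the mean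
        value theorem in direction \<open>w\<close> leaves an increment of \<open>g\<close> along
        \<open>t *\<^sub>R v\<close>. Writing \<open>0 *\<^sub>R v\<close> gives both terms the
        shape used in \<open>inU\<close> and \<open>R\<close>.\<close>
      define f where "f s = F (x + t *\<^sub>R v + s *\<^sub>R w) - F (x + 0 *\<^sub>R v + s *\<^sub>R w)" for s
      define f' where "f' s = (g (x + t *\<^sub>R v + s *\<^sub>R w) - g (x + 0 *\<^sub>R v + s *\<^sub>R w)) \<bullet> w" for s
      have "(f has_real_derivative f' s) (at s)" if "0 \<le> s" "s \<le> t" for s
      proof -
        have 1: "((\<lambda>s. F (x + a *\<^sub>R v + s *\<^sub>R w)) has_derivative (\<lambda>h. g (x + a *\<^sub>R v + s *\<^sub>R w) \<bullet> (h *\<^sub>R w))) (at s)"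
          if a: "0 \<le> a" "a \<le> t" for a
          by (rule has_derivative_compose[where f = "\<lambda>s. x + a *\<^sub>R v + s *\<^sub>R w" and g = F,
                OF _ F[OF inU[OF a \<open>0 \<le> s\<close> \<open>s \<le> t\<close>]]])
             (auto intro!: derivative_eq_intros)
        show ?thesis
          unfolding has_field_derivative_def f_def
          by (rule has_derivative_eq_rhs[OF has_derivative_diff[OF 1 1]])
             (use t in \<open>auto simp: f'_def inner_diff_left algebra_simps\<close>)
      qed
      then obtain s where s: "0 < s" "s < t" "f t - f 0 = (t - 0) * f' s"
        using MVT2[of 0 t f f'] t by auto
      \<comment> \<open>In the increment of \<open>g\<close> the linear parts leave exactly
        \<open>t *\<^sub>R H v\<close>; the error consists of two remainders of size at most
        \<open>e' * (t * K)\<close>.\<close>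
      define R where "R y = g y - g x - H (y - x)" for y
      have R: "norm (R (x + a *\<^sub>R v + s *\<^sub>R w)) \<le> e' * (t * K)" if "0 \<le> a" "a \<le> t" for a
      proof -
        have n: "norm (a *\<^sub>R v + s *\<^sub>R w) \<le> t * K"
          using small that s by simp
        then have "norm (R (x + a *\<^sub>R v + s *\<^sub>R w)) \<le> e' * norm (a *\<^sub>R v + s *\<^sub>R w)"
          using d1(2)[of "x + a *\<^sub>R v + s *\<^sub>R w"] tK by (auto simp: R_def d_def add.assoc)
        also have "\<dots> \<le> e' * (t * K)"
          using n \<open>e' > 0\<close> by simp
        finally show ?thesis .
      qed
      have "\<Delta> t v w = t * f' s"
        using s(3) by (simp add: f_def \<Delta>_def)
      moreover have "f' s = t * (H v \<bullet> w) + (R (x + t *\<^sub>R v + s *\<^sub>R w) - R (x + 0 *\<^sub>R v + s *\<^sub>R w)) \<bullet> w"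
        by (simp add: f'_def R_def H.add H.scaleR inner_diff_left inner_add_left algebra_simps)
      ultimately have "\<Delta> t v w / t\<^sup>2 - H v \<bullet> w
          = ((R (x + t *\<^sub>R v + s *\<^sub>R w) - R (x + 0 *\<^sub>R v + s *\<^sub>R w)) \<bullet> w) / t"
        using t by (simp add: field_simps power2_eq_square)
      also have "\<bar>\<dots>\<bar> \<le> (e' * (t * K) + e' * (t * K)) * norm w / t"
      proof -
        have "\<bar>(R (x + t *\<^sub>R v + s *\<^sub>R w) - R (x + 0 *\<^sub>R v + s *\<^sub>R w)) \<bullet> w\<bar>
            \<le> norm (R (x + t *\<^sub>R v + s *\<^sub>R w) - R (x + 0 *\<^sub>R v + s *\<^sub>R w)) * norm w"
          by (rule Cauchy_Schwarz_ineq2)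
        also have "\<dots> \<le> (e' * (t * K) + e' * (t * K)) * norm w"
          using R[of t] R[of 0] t by (intro mult_right_mono norm_triangle_le_diff add_mono) auto
        finally show ?thesis
          using t by (simp only: abs_divide abs_of_pos) (simp only: divide_right_mono less_imp_le)
      qed
      also have "\<dots> = 2 * e' * K * norm w"
        using t by (simp add: field_simps)
      also have "\<dots> \<le> 2 * e' * K * K"
        using K \<open>e' > 0\<close> by (intro mult_left_mono) auto
      also have "\<dots> < e"
        using K \<open>e > 0\<close> by (simp add: e'_def field_simps)
      finally show "dist (\<Delta> t v w / t\<^sup>2) (H v \<bullet> w) < e"
        by (simp add: dist_real_def)
    qed
  qed
  have "\<Delta> t v w = \<Delta> t w v" for t
    by (simp add: \<Delta>_def algebra_simps)
  then show ?thesis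
    using lim[of v w] lim[of w v] tendsto_unique[of "at_right (0::real)"] by simp
qed

text \<open>The bounded linear map \<open>L\<close> represents a functional by a vector. Composing
  it with the second derivative turns the Hessian into a self-adjoint operator that inherits
  continuity.\<close>

lemma C2_on_gradient:
  fixes F :: "real^'n \<Rightarrow> real"
  assumes F: "C2_on U F" and U: "open U"
  obtains H :: "(real^'n) \<Rightarrow> (real^'n) \<Rightarrow>\<^sub>L (real^'n)" where
    "\<And>x. x \<in> U \<Longrightarrow> (F has_derivative (\<lambda>v. gradient F x \<bullet> v)) (at x)"
    "\<And>x. x \<in> U \<Longrightarrow> (gradient F has_derivative H x) (at x)"
    "continuous_on U H"
    "\<And>x v w. x \<in> U \<Longrightarrow> H x v \<bullet> w = H x w \<bullet> v"
proof -
  obtain f' :: "real^'n \<Rightarrow> (real^'n) \<Rightarrow>\<^sub>L real" and f'' where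
    f': "\<And>x. x \<in> U \<Longrightarrow> (F has_derivative blinfun_apply (f' x)) (at x)" and
    f'': "\<And>x. x \<in> U \<Longrightarrow> (f' has_derivative blinfun_apply (f'' x)) (at x)" and c: "continuous_on U f''"
    using F by (force simp: C2_on_def C1_on_def)
  define L :: "((real^'n) \<Rightarrow>\<^sub>L real) \<Rightarrow> real^'n"
    where "L b = (\<Sum>i\<in>UNIV. blinfun_apply b (axis i 1) *\<^sub>R axis i 1)" for b
  have L: "bounded_linear L"
    unfolding L_def
    by (intro bounded_linear_sum bounded_linear_scaleR_const blinfun.bounded_linear_left)
  have Lnth: "L b $ i = b (axis i 1)" for b i
    by (simp add: L_def axis_def if_distrib[where f="\<lambda>a. _ * a"] cong: if_cong)
  have grad: "gradient F x = L (f' x)" if "x \<in> U" for x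
    using frechet_derivative_at[OF f'[OF that]]
    by (auto simp: vec_eq_iff Lnth gradient_def partial_def)
  have inner_L: "L b \<bullet> v = b v" for b v
  proof -
    have "b v = b (\<Sum>i\<in>UNIV. v $ i *\<^sub>R axis i 1)"
      by (metis basis_expansion scalar_mult_eq_scaleR)
    then show ?thesis
      by (simp add: blinfun.bilinear_simps blinfun.sum_right inner_vec_def Lnth mult.commute)
  qed
  define H where "H x = Blinfun L o\<^sub>L f'' x" for x
  have 1: "(F has_derivative (\<lambda>v. gradient F x \<bullet> v)) (at x)" if "x \<in> U" for x
    using f'[OF that] by (simp add: grad[OF that] inner_L)
  have 2: "(gradient F has_derivative H x) (at x)" if "x \<in> U" for x
  proof -
    have "((\<lambda>x. L (f' x)) has_derivative H x) (at x)"
      using bounded_linear.has_derivative[OF L f''[OF that]]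
      by (simp add: H_def bounded_linear_Blinfun_apply[OF L] blinfun_compose.rep_eq comp_def)
    then show ?thesis
      by (rule has_derivative_transform_within_open[OF _ U that]) (simp add: grad)
  qed
  show thesis
  proof
    show "continuous_on U H"
      unfolding H_def by (intro continuous_intros c)
    show "H x v \<bullet> w = H x w \<bullet> v" if "x \<in> U" for x v w
      by (rule second_derivative_symmetric[OF U that 1 2[OF that]])
  qed (use 1 2 in auto)
qed

lemma partial_partial:
  assumes "(gradient F has_derivative H) (at x)"
  shows "partial j (partial i F) x = H (axis j 1) $ i"
proof -
  have "(partial i F has_derivative (\<lambda>v. H v $ i)) (at x)"
    using bounded_linear.has_derivative[OF bounded_linear_vec_nth assms, of i]
    by (simp add: gradient_def)
  then show ?thesis
    unfolding partial_def[of j "partial i F"] by (metis frechet_derivative_at)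
qed

section \<open>Tangent spaces of level sets\<close>

text \<open>A curve in \<open>\<Sigma>\<close> with velocity \<open>v\<close> stays in
  \<open>W\<close> for small times, so \<open>h\<close> is constant along it. The lemma serves for
  \<open>F\<close> itself, for a single partial derivative, and for an expression comparing two
  normals.\<close>

lemma has_derivative_tangent_eq_0:
  fixes h :: "real^'n \<Rightarrow> 'b::real_normed_vector"
  assumes h: "(h has_derivative h') (at x)" and v: "v \<in> tangent_space \<Sigma> x"
    and W: "open W" "x \<in> W" "\<And>y. y \<in> \<Sigma> \<inter> W \<Longrightarrow> h y = 0"
  shows "h' v = 0"
proof -
  obtain \<gamma> \<epsilon> where \<gamma>: "\<gamma> 0 = x" "\<epsilon> > 0" "\<And>t. \<bar>t\<bar> < \<epsilon> \<Longrightarrow> \<gamma> t \<in> \<Sigma>"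
      "(\<gamma> has_vector_derivative v) (at 0)"
    using v by (auto simp: tangent_space_def)
  have d: "((\<lambda>t. h (\<gamma> t)) has_derivative (\<lambda>t. h' (t *\<^sub>R v))) (at 0)"
    using has_derivative_compose[of \<gamma> "\<lambda>t. t *\<^sub>R v" 0 UNIV h h'] \<gamma> h
    by (simp add: has_vector_derivative_def)
  have "isCont \<gamma> 0"
    using \<gamma>(4) has_vector_derivative_continuous by blast
  then have "\<forall>\<^sub>F t in at 0. \<gamma> t \<in> W"
    using topological_tendstoD[of \<gamma> "\<gamma> 0" "at 0" W] W \<gamma>(1) by (auto simp: isCont_def)
  moreover have "\<forall>\<^sub>F t in at 0. \<bar>t::real\<bar> < \<epsilon>"
    using \<gamma>(2) by (auto simp: eventually_at intro!: exI[of _ \<epsilon>])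
  ultimately have ev: "\<forall>\<^sub>F t in at 0. h (\<gamma> t) = 0"
    by eventually_elim (use W(3) \<gamma>(3) in auto)
  have "((\<lambda>t. 0) has_derivative (\<lambda>t. h' (t *\<^sub>R v))) (at 0)"
    by (rule has_derivative_transform_eventually[OF d ev]) (use W \<gamma> in force)+
  then have "(\<lambda>t::real. h' (t *\<^sub>R v)) = (\<lambda>t. 0)"
    by (rule has_derivative_unique) (rule has_derivative_const)
  then have "h' (1 *\<^sub>R v) = 0"
    by meson
  then show ?thesis
    by simp
qed

text \<open>The map \<open>y + (F y - g \<bullet> (y - x)) g / |g|\<^sup>2\<close>, with \<open>g\<close> the gradient at \<open>x\<close>, straightens \<open>\<Sigma>\<close>
  into the affine tangent hyperplane at \<open>x\<close> and has the identity as its derivative there.\<close>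

lemma tangent_space_eq_gradient_orthogonal:
  fixes F :: "real^'n \<Rightarrow> real"
  assumes reg: "regular_defining_function \<Sigma> p U F" and x: "x \<in> \<Sigma> \<inter> U"
  shows "tangent_space \<Sigma> x = {v. gradient F x \<bullet> v = 0}"
proof (intro subset_antisym subsetI CollectI)
  have U: "open U" "C2_on U F" "\<Sigma> \<inter> U = {x \<in> U. F x = 0}" and nz: "gradient F x \<noteq> 0"
    using reg x by (auto simp: regular_defining_function_def)
  obtain H :: "_ \<Rightarrow> _ \<Rightarrow>\<^sub>L _" where
    F: "\<And>x. x \<in> U \<Longrightarrow> (F has_derivative (\<lambda>v. gradient F x \<bullet> v)) (at x)" and
    G: "\<And>x. x \<in> U \<Longrightarrow> (gradient F has_derivative H x) (at x)"
    using C2_on_gradient[OF U(2,1)] by metis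
  show "gradient F x \<bullet> v = 0" if "v \<in> tangent_space \<Sigma> x" for v
    by (rule has_derivative_tangent_eq_0[OF F that U(1)]) (use x U in auto)
  define g where "g = gradient F x"
  \<comment> \<open>Normalized so that \<open>g \<bullet> c = 1\<close>; hence
    \<open>g \<bullet> (\<Phi> y - x) = F y\<close>, and \<open>\<Phi>\<close> sends zeros of
    \<open>F\<close> into the affine tangent hyperplane.\<close>
  define c where "c = g /\<^sub>R (g \<bullet> g)"
  have gc: "g \<bullet> c = 1"
    using nz by (simp add: c_def g_def)
  define \<Phi> where "\<Phi> y = y + (F y - g \<bullet> (y - x)) *\<^sub>R c" for y
  define \<Phi>' where "\<Phi>' y = id_blinfun + (blinfun_scaleR_left c o\<^sub>L blinfun_inner_right (gradient F y - g))" for y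
  have d: "(\<Phi> has_derivative \<Phi>' y) (at y)" if "y \<in> U" for y
    unfolding \<Phi>_def
    by (auto intro!: derivative_eq_intros F[OF that] ext
        simp: \<Phi>'_def blinfun.bilinear_simps inner_diff_left)
  have cont: "continuous_on U (gradient F)"
    by (rule has_derivative_continuous_on[OF has_derivative_at_withinI[OF G]])
  have c': "continuous_on U \<Phi>'"
    unfolding \<Phi>'_def
    by (intro continuous_intros cont bounded_linear.continuous_on[OF bounded_linear_blinfun_inner_right])
  have id: "id_blinfun o\<^sub>L \<Phi>' x = id_blinfun"
    by (intro blinfun_eqI) (simp add: \<Phi>'_def g_def blinfun.bilinear_simps)
  obtain U' V \<Psi> \<Psi>' where inv: "open U'" "U' \<subseteq> U" "x \<in> U'" "open V" "\<Phi> x \<in> V" "homeomorphism U' V \<Phi> \<Psi>"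
    "\<And>y. y \<in> V \<Longrightarrow> (\<Psi> has_derivative \<Psi>' y) (at y)"
    "\<And>y. y \<in> V \<Longrightarrow> \<Psi>' y = inv (blinfun_apply (\<Phi>' (\<Psi> y)))"
    using inverse_function_theorem[OF U(1) d c' _ id] x by (metis IntD2)
  have Fx: "F x = 0"
    using x U by auto
  then have \<Phi>x: "\<Phi> x = x"
    by (simp add: \<Phi>_def)
  then have \<Psi>x: "\<Psi> x = x"
    using inv(3,6) by (metis homeomorphism_apply1)
  have "blinfun_apply (\<Phi>' x) = id"
    using id by (auto simp: fun_eq_iff \<Phi>'_def g_def blinfun.bilinear_simps)
  then have d\<Psi>: "(\<Psi> has_derivative (\<lambda>v. v)) (at x)"
    using inv(7,8)[of x] inv(5) by (simp add: \<Phi>x \<Psi>x id_def inv_id[unfolded id_def])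
  fix v
  assume "v \<in> {v. gradient F x \<bullet> v = 0}"
  then have v: "g \<bullet> v = 0"
    by (simp add: g_def)
  have "\<forall>\<^sub>F y in nhds x. y \<in> V"
    using inv(4,5) \<Phi>x eventually_nhds by metis
  moreover have "((\<lambda>t::real. x + t *\<^sub>R v) \<longlongrightarrow> x) (nhds 0)"
    by (rule tendsto_eq_rhs[OF tendsto_add[OF tendsto_const tendsto_scaleR[OF filterlim_ident tendsto_const]]]) simp
  ultimately have "\<forall>\<^sub>F t::real in nhds 0. x + t *\<^sub>R v \<in> V"
    by (rule eventually_compose_filterlim)
  then obtain \<epsilon> where \<epsilon>: "\<epsilon> > 0" "\<And>t. \<bar>t\<bar> < \<epsilon> \<Longrightarrow> x + t *\<^sub>R v \<in> V"
    by (auto simp: eventually_nhds_metric dist_real_def)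
  \<comment> \<open>The curve realizing \<open>v\<close> is a straight line in the tangent
    hyperplane pulled back by the local inverse; its velocity is \<open>v\<close> because
    \<open>\<Psi>\<close> has the identity as derivative at \<open>x\<close>.\<close>
  have "\<Psi> (x + t *\<^sub>R v) \<in> \<Sigma>" if "\<bar>t\<bar> < \<epsilon>" for t
  proof -
    define y where "y = \<Psi> (x + t *\<^sub>R v)"
    have y: "\<Phi> y = x + t *\<^sub>R v" "y \<in> U'"
      using \<epsilon>(2)[OF that] inv(6) by (auto simp: y_def homeomorphism_def)
    have "g \<bullet> (\<Phi> y - x) = F y"
      by (simp add: \<Phi>_def gc algebra_simps inner_diff_right inner_add_right)
    then have "F y = 0"
      by (simp add: y v)
    then show ?thesis
      using y U(3) inv(2) unfolding y_def by blast
  qed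
  moreover have "((\<lambda>t. \<Psi> (x + t *\<^sub>R v)) has_vector_derivative v) (at 0)"
    unfolding has_vector_derivative_def
    by (rule has_derivative_compose[of "\<lambda>t. x + t *\<^sub>R v" "\<lambda>t. t *\<^sub>R v" 0 UNIV \<Psi> "\<lambda>v. v"])
       (auto intro!: derivative_eq_intros simp: d\<Psi>)
  ultimately show "v \<in> tangent_space \<Sigma> x"
    using \<epsilon>(1) \<Psi>x by (auto simp: tangent_space_def intro!: exI[of _ "\<lambda>t. \<Psi> (x + t *\<^sub>R v)"] exI[of _ \<epsilon>])
qed

section \<open>Vanishing of the Hessian on the tangent space\<close>

text \<open>Off the zero coordinates of \<open>g\<close>, the form \<open>q i j = H (e i / g i) \<bullet> (e j / g j)\<close> satisfies
  \<open>q i i + q j j = 2 q i j\<close>, so it vanishes on pairs of coefficient vectors of total sum zero.\<close>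

lemma quadratic_form_eq_0_on_orthogonal:
  fixes H :: "real^'n \<Rightarrow> real^'n" and g :: "real^'n"
  assumes H: "linear H" and sym: "\<And>v w. H v \<bullet> w = H w \<bullet> v"
    and Z: "\<And>v i. g \<bullet> v = 0 \<Longrightarrow> g $ i = 0 \<Longrightarrow> H v $ i = 0"
    and C: "\<And>i j. g $ i \<noteq> 0 \<Longrightarrow> g $ j \<noteq> 0 \<Longrightarrow>
      (g $ j)\<^sup>2 * H (axis i 1) $ i + (g $ i)\<^sup>2 * H (axis j 1) $ j - 2 * g $ i * g $ j * H (axis j 1) $ i = 0"
    and v: "g \<bullet> v = 0" and w: "g \<bullet> w = 0"
  shows "H v \<bullet> w = 0"
proof -
  define J where "J = {i. g $ i \<noteq> 0}"
  define P where "P u = (\<Sum>i\<in>J. u $ i *\<^sub>R axis i 1 :: real^'n)" for u :: "real^'n"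
  have P: "u \<bullet> P z = (\<Sum>i\<in>J. u $ i * z $ i)" for u z
    by (simp add: P_def inner_sum_right inner_axis mult.commute)
  have sumJ: "(\<Sum>i\<in>J. g $ i * u $ i) = g \<bullet> u" for u
    unfolding inner_vec_def by (intro sum.mono_neutral_cong_left) (auto simp: J_def)
  \<comment> \<open>By \<open>Z\<close>, \<open>H u\<close> has no component outside
    \<open>J\<close>, so only the part of \<open>z\<close> supported in \<open>J\<close>
    counts.\<close>
  have reduce: "H u \<bullet> z = H u \<bullet> P z" if "g \<bullet> u = 0" for u z
    unfolding P unfolding inner_vec_def
    by (intro sum.mono_neutral_cong_right) (auto simp: J_def Z[OF that])
  define q where "q i = H (axis i 1) $ i / (g $ i)\<^sup>2" for i
  \<comment> \<open>Dividing \<open>C\<close> by the squares of both coordinates makes each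
    normalized off-diagonal entry the average of the two diagonal ones.\<close>
  have q: "H (axis j 1) $ i = g $ i * g $ j * (q i + q j) / 2" if "i \<in> J" "j \<in> J" for i j
  proof -
    have nz: "g $ i \<noteq> 0" "g $ j \<noteq> 0"
      using that by (auto simp: J_def)
    have "2 * g $ i * g $ j * H (axis j 1) $ i = (g $ j)\<^sup>2 * H (axis i 1) $ i + (g $ i)\<^sup>2 * H (axis j 1) $ j"
      using C[OF nz] by simp
    also have "\<dots> = (g $ i)\<^sup>2 * (g $ j)\<^sup>2 * (q i + q j)"
      using nz by (simp add: q_def field_simps)
    finally have "(2 * (g $ i * g $ j)) * H (axis j 1) $ i = (2 * (g $ i * g $ j)) * (g $ i * g $ j * (q i + q j) / 2)"
      by (simp add: power2_eq_square algebra_simps)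
    then show ?thesis
      using nz by (simp only: mult_cancel_left) simp
  qed
  have gP: "g \<bullet> P z = g \<bullet> z" for z
    by (simp add: P sumJ)
  \<comment> \<open>Truncation keeps the inner product with \<open>g\<close>, so \<open>P w\<close>
    is again orthogonal to \<open>g\<close>. Hence \<open>reduce\<close> applies once to each
    argument, with symmetry swapping them in between.\<close>
  have "H v \<bullet> w = H (P w) \<bullet> P v"
    using reduce[OF v, of w] reduce[of "P w" v] gP[of w] w sym[of v "P w"] by simp
  also have "\<dots> = (\<Sum>i\<in>J. \<Sum>j\<in>J. (w $ j * v $ i) * H (axis j 1) $ i)"
    unfolding P by (simp add: P_def linear_sum[OF H] linear_scale[OF H] sum_distrib_left mult_ac)
  also have "\<dots> = (\<Sum>i\<in>J. \<Sum>j\<in>J. (g $ i * v $ i * q i / 2) * (g $ j * w $ j) + (g $ i * v $ i) * (g $ j * w $ j * q j / 2))"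
    by (intro sum.cong refl) (simp add: q field_simps)
  \<comment> \<open>Each summand depends on \<open>i\<close> and \<open>j\<close> separately, so the
    double sum splits into products, one with factor \<open>g \<bullet> w\<close> and the other with
    factor \<open>g \<bullet> v\<close>.\<close>
  also have "\<dots> = (\<Sum>i\<in>J. g $ i * v $ i * q i / 2) * (\<Sum>j\<in>J. g $ j * w $ j)
      + (\<Sum>i\<in>J. g $ i * v $ i) * (\<Sum>j\<in>J. g $ j * w $ j * q j / 2)"
    by (simp only: sum.distrib sum_product)
  also have "\<dots> = 0"
    by (simp add: sumJ v w)
  finally show ?thesis .
qed

text \<open>Density and continuity are combined in one contradiction: a nonzero value at
  \<open>p\<close> persists on a relatively open piece of \<open>\<Sigma>\<close>, and that piece
  contains a point where the algebraic lemma forces zero.\<close>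

lemma hessian_eq_0_on_tangent_space:
  fixes \<Sigma> :: "(real^'n::{finite,linorder}) set" and H :: "_ \<Rightarrow> _ \<Rightarrow>\<^sub>L _"
  assumes reg: "regular_defining_function \<Sigma> p U F" and p: "p \<in> \<Sigma> \<inter> U"
    and C: "\<And>i j x. i < j \<Longrightarrow> x \<in> \<Sigma> \<inter> U \<Longrightarrow> Cij i j F x = 0"
    and G: "\<And>x. x \<in> U \<Longrightarrow> (gradient F has_derivative H x) (at x)"
    and contH: "continuous_on U H"
    and sym: "\<And>x v w. x \<in> U \<Longrightarrow> H x v \<bullet> w = H x w \<bullet> v"
    and v: "gradient F p \<bullet> v = 0" and w: "gradient F p \<bullet> w = 0"
  shows "H p v \<bullet> w = 0"
proof (rule ccontr)
  assume neq: "H p v \<bullet> w \<noteq> 0"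
  define g where "g = gradient F"
  have U: "open U" and nz: "\<And>x. x \<in> \<Sigma> \<inter> U \<Longrightarrow> g x \<noteq> 0"
    using reg by (auto simp: regular_defining_function_def g_def)
  have contg: "continuous_on U g"
    unfolding g_def by (rule has_derivative_continuous_on[OF has_derivative_at_withinI[OF G]])
  \<comment> \<open>The hypothesis covers only \<open>i < j\<close>; symmetry of the Hessian gives
    \<open>j < i\<close>, and for \<open>i = j\<close> the expression cancels identically.\<close>
  have C': "(g x $ j)\<^sup>2 * H x (axis i 1) $ i + (g x $ i)\<^sup>2 * H x (axis j 1) $ j
      - 2 * g x $ i * g x $ j * H x (axis j 1) $ i = 0" if x: "x \<in> \<Sigma> \<inter> U" for i j x
  proof -
    have eq: "Cij i j F x = (g x $ j)\<^sup>2 * H x (axis i 1) $ i + (g x $ i)\<^sup>2 * H x (axis j 1) $ j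
      - 2 * g x $ i * g x $ j * H x (axis j 1) $ i" for i j
      using partial_partial[OF G] x by (simp add: Cij_def g_def gradient_def)
    have "H x (axis j 1) $ i = H x (axis i 1) $ j" for i j
      using sym[of x "axis j 1" "axis i 1"] x by (simp add: inner_axis)
    then have "Cij i j F x = Cij j i F x" for i j
      unfolding eq by (simp add: algebra_simps)
    moreover have "Cij i i F x = 0"
      unfolding eq by (simp add: power2_eq_square)
    ultimately show ?thesis
      using C x unfolding eq[symmetric] by (metis linorder_neqE)
  qed
  \<comment> \<open>Tangential up to scale; polynomial in the gradient, so continuity of \<open>k\<close> is immediate.\<close>
  define \<pi> where "\<pi> u x = (g x \<bullet> g x) *\<^sub>R u - (g x \<bullet> u) *\<^sub>R g x" for u x
  have \<pi>: "g x \<bullet> \<pi> u x = 0" for u x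
    by (simp add: \<pi>_def inner_diff_right)
  define k where "k x = H x (\<pi> v x) \<bullet> \<pi> w x" for x
  have "continuous_on U k"
    unfolding k_def \<pi>_def by (intro continuous_intros contg contH)
  then have W: "open (U \<inter> k -` (- {0}))" (is "open ?W")
    using U continuous_open_preimage by blast
  have "k p = (g p \<bullet> g p)\<^sup>2 * (H p v \<bullet> w)"
    using v w by (simp add: k_def \<pi>_def g_def blinfun.bilinear_simps power2_eq_square)
  then have pW: "p \<in> \<Sigma> \<inter> ?W"
    using p neq nz by auto
  define J where "J x = {i. g x $ i \<noteq> 0}" for x
  \<comment> \<open>A maximum exists because the number of nonzero partials is bounded by the
    dimension.\<close>
  have "\<exists>x. x \<in> \<Sigma> \<inter> ?W \<and> (\<forall>y. y \<in> \<Sigma> \<inter> ?W \<longrightarrow> card (J y) \<le> card (J x))"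
    using pW by (intro ex_has_greatest_nat[of _ p _ "Suc CARD('n)"]) (auto simp: less_Suc_eq_le intro!: card_mono)
  then obtain x where x: "x \<in> \<Sigma> \<inter> ?W" and max: "\<And>y. y \<in> \<Sigma> \<inter> ?W \<Longrightarrow> card (J y) \<le> card (J x)"
    by blast
  \<comment> \<open>Partials nonzero at \<open>x\<close> stay nonzero on \<open>W'\<close>; by
    maximality no others can become nonzero on \<open>\<Sigma> \<inter> W'\<close>.\<close>
  define W' where "W' = ?W \<inter> (\<Inter>i\<in>J x. U \<inter> (\<lambda>y. g y $ i) -` (- {0}))"
  have "open W'"
    unfolding W'_def
    by (intro open_Int W open_INT ballI continuous_open_preimage continuous_intros contg U) auto
  have xW': "x \<in> W'"
    using x by (auto simp: W'_def J_def)
  have J: "J y = J x" if "y \<in> \<Sigma> \<inter> W'" for y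
  proof -
    have "J x \<subseteq> J y"
      using that unfolding W'_def J_def by blast
    moreover have "card (J y) \<le> card (J x)"
      using max that by (auto simp: W'_def)
    ultimately show ?thesis
      by (metis card_seteq finite)
  qed
  have xU: "x \<in> \<Sigma> \<inter> U"
    using x by auto
  \<comment> \<open>A partial vanishing at \<open>x\<close> vanishes on \<open>\<Sigma>\<close> near
    \<open>x\<close>, so its derivative along tangent vectors is zero; these are all vectors
    orthogonal to the gradient.\<close>
  have Z: "H x u $ i = 0" if u: "g x \<bullet> u = 0" and i: "g x $ i = 0" for u i
  proof (rule has_derivative_tangent_eq_0[where h = "\<lambda>y. g y $ i" and h' = "\<lambda>u. H x u $ i"])
    show "((\<lambda>y. g y $ i) has_derivative (\<lambda>u. H x u $ i)) (at x)"
      unfolding g_def using G xU by (intro bounded_linear.has_derivative[OF bounded_linear_vec_nth]) auto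
    show "u \<in> tangent_space \<Sigma> x"
      using tangent_space_eq_gradient_orthogonal[OF reg xU] u by (simp add: g_def)
    show "g y $ i = 0" if "y \<in> \<Sigma> \<inter> W'" for y
      using J[OF that] i by (auto simp: J_def)
  qed (use \<open>open W'\<close> xW' in auto)
  have "k x = 0"
    unfolding k_def
    by (rule quadratic_form_eq_0_on_orthogonal[of _ "g x"])
       (use xU sym Z C' \<pi> in \<open>auto simp: bounded_linear.linear blinfun.bounded_linear_right\<close>)
  then show False
    using x by auto
qed

section \<open>From the Hessian to the second fundamental form\<close>

theorem lemma2p10:
  fixes \<Sigma> :: "(real ^ 'n::{finite,linorder}) set"
  assumes "CARD('n) \<ge> 2"
    and "embedded_C2_hypersurface \<Sigma>"
    and "\<forall>p\<in>\<Sigma>. \<exists>U F. regular_defining_function \<Sigma> p U F \<and>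
           (\<forall>i j. i < j \<longrightarrow> (\<forall>x \<in> \<Sigma> \<inter> U. Cij i j F x = 0))"
  shows "second_fundamental_form_vanishes \<Sigma>"
  unfolding second_fundamental_form_vanishes_def
proof (intro allI impI ballI)
  fix A N p v w
  assume N: "local_unit_normal \<Sigma> A N" and p: "p \<in> \<Sigma> \<inter> A"
    and v: "v \<in> tangent_space \<Sigma> p" and w: "w \<in> tangent_space \<Sigma> p"
  obtain U F where reg: "regular_defining_function \<Sigma> p U F"
    and C: "\<And>i j x. i < j \<Longrightarrow> x \<in> \<Sigma> \<inter> U \<Longrightarrow> Cij i j F x = 0"
    using assms(3) p by (metis IntD1)
  have U: "open U" "C2_on U F" "p \<in> \<Sigma> \<inter> U"
    using reg p by (auto simp: regular_defining_function_def)
  obtain H :: "_ \<Rightarrow> _ \<Rightarrow>\<^sub>L _" where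
    G: "\<And>x. x \<in> U \<Longrightarrow> (gradient F has_derivative H x) (at x)" and
    H: "continuous_on U H" "\<And>x v w. x \<in> U \<Longrightarrow> H x v \<bullet> w = H x w \<bullet> v"
    using C2_on_gradient[OF U(2,1)] by metis
  define g where "g = gradient F"
  have tangent: "tangent_space \<Sigma> x = {v. g x \<bullet> v = 0}" if "x \<in> \<Sigma> \<inter> U" for x
    using tangent_space_eq_gradient_orthogonal[OF reg that] by (simp add: g_def)
  have vw: "g p \<bullet> v = 0" "g p \<bullet> w = 0"
    using v w tangent U(3) by auto
  obtain N' where N': "(N has_derivative N') (at p)" and A: "open A"
    using N p by (auto simp: local_unit_normal_def C1_on_def)
  define h where "h x = (N x \<bullet> w) * (g x \<bullet> g x) - (N x \<bullet> g x) * (g x \<bullet> w)" for x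
  \<comment> \<open>\<open>N\<close> is parallel to \<open>g\<close> along \<open>\<Sigma>\<close>; \<open>h\<close> encodes this without division.\<close>
  have "h x = 0" if x: "x \<in> \<Sigma> \<inter> (A \<inter> U)" for x
  proof -
    have "(g x \<bullet> g x) *\<^sub>R w - (g x \<bullet> w) *\<^sub>R g x \<in> tangent_space \<Sigma> x"
      using tangent x by (simp add: inner_diff_right)
    then have "N x \<bullet> ((g x \<bullet> g x) *\<^sub>R w - (g x \<bullet> w) *\<^sub>R g x) = 0"
      using N x by (auto simp: local_unit_normal_def)
    then show ?thesis
      by (simp add: h_def inner_diff_right algebra_simps)
  qed
  moreover have G': "(g has_derivative H p) (at p)"
    using G U(3) by (simp add: g_def)
  have "(h has_derivative (\<lambda>u. (N p \<bullet> w) * (2 * (g p \<bullet> H p u)) + (N' u \<bullet> w) * (g p \<bullet> g p)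
      - ((N p \<bullet> g p) * (H p u \<bullet> w) + (N p \<bullet> H p u + N' u \<bullet> g p) * (g p \<bullet> w)))) (at p)"
    unfolding h_def
    by (rule has_derivative_eq_rhs, (rule derivative_eq_intros N' G' refl)+)
       (auto simp: fun_eq_iff inner_commute algebra_simps)
  \<comment> \<open>Once \<open>N p \<bullet> w\<close>, \<open>H p v \<bullet> w\<close> and
    \<open>g p \<bullet> w\<close> are known to vanish, only
    \<open>(N' v \<bullet> w) * (g p \<bullet> g p)\<close> survives here.\<close>
  ultimately have "(N p \<bullet> w) * (2 * (g p \<bullet> H p v)) + (N' v \<bullet> w) * (g p \<bullet> g p)
      - ((N p \<bullet> g p) * (H p v \<bullet> w) + (N p \<bullet> H p v + N' v \<bullet> g p) * (g p \<bullet> w)) = 0"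
    using has_derivative_tangent_eq_0[of h _ p v \<Sigma> "A \<inter> U"] v A U p by blast
  moreover have "N p \<bullet> w = 0"
    using N p w by (auto simp: local_unit_normal_def)
  moreover have "H p v \<bullet> w = 0"
    by (rule hessian_eq_0_on_tangent_space[OF reg U(3) C G H]) (use vw in \<open>auto simp: g_def\<close>)
  moreover have "g p \<noteq> 0"
    using reg U(3) by (auto simp: regular_defining_function_def g_def)
  ultimately have "N' v \<bullet> w = 0"
    using vw by simp
  then show "second_fundamental_form N p v w = 0"
    using frechet_derivative_at[OF N'] by (simp add: second_fundamental_form_def)
qed

end
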